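(* For any integer $k$ with $k>0$, $$\beta(2k) = (-1)^{k+1}\,\frac{(\pi/2)^{2k-1}}{(2k-1)!}\,\ln 2 \;-\; (-1)^{k}\sum_{m=1}^{k-1}\frac{(-1)^m\,(\pi/2)^{2k-2m-1}}{(2k-2m-1)!}\left(1-\frac{1}{2^{2m}}\right)\zeta(2m+1)\;+\;(-1)^k\,\frac{\pi^{2k+1}}{2^{2k+2}}\sum_{m=0}^{\infty}(-1)^m\,\frac{\pi^{2m}\,E_{2m+1}(1)}{(2m+2k+1)!\cdot 2^{2m}}\,.$$
   Context: Here $\beta$ is the Dirichlet beta function, $\beta(s)=\sum_{j=0}^{\infty}\frac{(-1)^j}{(2j+1)^s}$ for real $s>0$; $\zeta$ is the Riemann zeta function, $\zeta(s)=\sum_{n=1}^{\infty}\frac{1}{n^s}$ for real $s>1$; and $E_n(x)$ is the Euler polynomial of degree $n$, determined by the generating function $\frac{2e^{xt}}{e^t+1}=\sum_{n=0}^{\infty}E_n(x)\frac{t^n}{n!}$ (equivalently $E_n(x)=\sum_{j=0}^{n}\binom{n}{j}\frac{E_j}{2^j}\left(x-\frac12\right)^{n-j}$, where the Euler numbers $E_j$ are the coefficients of $z^j/j!$ in the Taylor expansion of $\operatorname{sech}(z)$ at $0$). The finite sum over $m$ from $1$ to $k-1$ is empty (equal to $0$) when $k=1$. *)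

theory Defs
  imports "HOL-Analysis.Analysis"
    "HOL-Real_Asymp.Real_Asymp"
begin

text \<open>Meaningful for \<open>s > 0\<close> only; the series is conditionally convergent for \<open>s \<le> 1\<close>,
  hence summed in the order of the indices.\<close>

definition dirichlet_beta :: "real \<Rightarrow> real" where
  "dirichlet_beta s = (\<Sum>j. (-1) ^ j / real (2 * j + 1) powr s)"

text \<open>Meaningful for \<open>s > 1\<close> only. The summation index is shifted to start from \<open>0\<close>.\<close>

definition riemann_zeta :: "real \<Rightarrow> real" where
  "riemann_zeta s = (\<Sum>n. 1 / real (Suc n) powr s)"

text \<open>
  \<open>fps_exp x\<close> is the formal power series of \<open>exp (x * t)\<close> in \<open>t\<close>, so this is \<open>n!\<close> times the
  coefficient of \<open>t ^ n\<close> in \<open>2 * exp (x * t) / (exp t + 1)\<close>.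
\<close>

definition euler_poly :: "nat \<Rightarrow> real \<Rightarrow> real" where
  "euler_poly n x = fact n * fps_nth (2 * fps_exp x / (fps_exp 1 + 1)) n"

lemma summable_riemann_zeta:
  assumes "s > 1"
  shows "summable (\<lambda>n. 1 / real (Suc n) powr s)"
proof -
  have "summable (\<lambda>n. real n powr (- s))"
    using assms by (simp add: summable_real_powr_iff)
  then have "summable (\<lambda>n. real (Suc n) powr (- s))"
    by (subst summable_Suc_iff)
  then show ?thesis
    by (simp add: powr_minus_divide)
qed

lemma summable_dirichlet_beta:
  assumes "s > 0"
  shows "summable (\<lambda>j. (-1) ^ j / real (2 * j + 1) powr s)"
proof -
  have "(\<lambda>j. 1 / real (2 * j + 1) powr s) \<longlonglongrightarrow> 0"
    using assms by real_asymp
  moreover have "monoseq (\<lambda>j. 1 / real (2 * j + 1) powr s)"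
    unfolding monoseq_def using assms
    by (intro disjI2 allI impI divide_left_mono powr_mono2 mult_pos_pos) auto
  ultimately have "summable (\<lambda>j. (-1) ^ j * (1 / real (2 * j + 1) powr s))"
    by (rule summable_Leibniz(1))
  then show ?thesis
    by simp
qed

lemma euler_poly_generating_function:
  "Abs_fps (\<lambda>n. euler_poly n x / fact n) * (fps_exp 1 + 1) = 2 * fps_exp x"
proof -
  have "Abs_fps (\<lambda>n. euler_poly n x / fact n) = 2 * fps_exp x / (fps_exp 1 + 1)"
    by (rule fps_ext) (simp add: euler_poly_def)
  moreover have "fps_exp (1::real) + 1 dvd 2 * fps_exp x"
    by (rule unit_imp_dvd) simp
  ultimately show ?thesis
    by (simp only: dvd_div_mult_self)
qed

lemma euler_poly_1: "euler_poly 1 x = x - 1 / 2"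
proof -
  let ?E = "Abs_fps (\<lambda>n. euler_poly n x / fact n)"
  have eq: "fps_nth (?E * (fps_exp 1 + 1)) n = fps_nth (2 * fps_exp x) n" for n
    by (simp only: euler_poly_generating_function)
  from eq[of 0] have "euler_poly 0 x = 1"
    by simp
  with eq[of 1] show ?thesis
    by (simp add: fps_mult_nth numeral_fps_const)
qed

end

theory Submission
  imports Defs
begin

text \<open>
  The two sides of the formula are two evaluations of one number, the value at \<open>\<pi> / 2\<close> of the
  \<open>2k\<close>-fold iterated primitive of \<open>tan (x / 2)\<close>, where every primitive vanishes at \<open>0\<close>.

  By power series: the generating function of the Euler polynomials at \<open>1\<close> is \<open>1 + tanh (t / 2)\<close>,
  hence \<open>tan (x / 2) = \<Sum>\<^sub>m (-1)\<^sup>m E\<^bsub>2m+1\<^esub>(1) x\<^bsup>2m+1\<^esup> / (2m+1)!\<close>, and integrating \<open>2k\<close> times turns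
  \<open>x\<^bsup>2m+1\<^esup> / (2m+1)!\<close> into \<open>x\<^bsup>2m+2k+1\<^esup> / (2m+2k+1)!\<close> (\<open>tan_integral_sums\<close>). Up to a factor, this is the
  infinite series of the theorem. Both the convergence and the identification with the
  tangent rest on the Riccati equation \<open>2 y' = 1 + y\<^sup>2\<close> of \<open>tan (x / 2)\<close>, read off from the
  generating function: it bounds the coefficients (\<open>Riccati_fps_coeff_bound\<close>) and
  determines the sum (\<open>eval_Riccati_fps\<close>).

  By Fourier series: formally \<open>tan (x / 2) = 2 \<Sum>\<^bsub>n\<ge>1\<^esub> (-1)\<^bsup>n-1\<^esup> sin (n x)\<close>. This series
  diverges unless \<open>x\<close> is a multiple of \<open>\<pi>\<close>, but it may be integrated term by term from \<open>0\<close> (\<open>tan_integral_Fourier_sums\<close>). Integrating \<open>sin (n x)\<close>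
  \<open>2k\<close> times yields \<open>(-1)\<^sup>k sin (n x) / n\<^bsup>2k\<^esup>\<close> plus a polynomial whose coefficients are odd powers
  of \<open>1 / n\<close> (\<open>sin_integral_even\<close>). At \<open>x = \<pi> / 2\<close> the sine terms add up to \<open>\<beta>(2k)\<close>, and the
  polynomials contribute \<open>\<Sum>\<^bsub>n\<ge>1\<^esub> (-1)\<^bsup>n-1\<^esup> / n\<^bsup>2m+1\<^esup>\<close> for \<open>m < k\<close>, that is \<open>ln 2\<close> and multiples of \<open>\<zeta>(2m + 1)\<close>.

  Term by term integration is justified by an estimate rather than by a limit theorem. The partial
  sums of the Fourier series have a closed form (\<open>alternating_sin_sum\<close>), so the remainder
  after \<open>N\<close> terms is \<open>\<plusminus> sin ((N + 1/2) x) / cos (x / 2)\<close>. One integration by parts makes its primitive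
  \<open>O(1 / N)\<close> uniformly on \<open>[0, \<pi> / 2]\<close> (\<open>fourier_remainder_1_bound\<close>), and further integrations
  preserve this.
\<close>

section \<open>Iterated primitives of power series\<close>

text \<open>
  Up to the factor \<open>r\<close>, integration divides the terms \<open>a\<^sub>n r\<^sup>n\<close> by \<open>n + 1\<close>, so the original series is
  a majorant.
\<close>

lemma fps_conv_radius_integral0_ge:
  fixes f :: "real fps"
  shows "fps_conv_radius f \<le> fps_conv_radius (fps_integral0 f)"
  unfolding fps_conv_radius_def
proof (rule conv_radius_geI_ex')
  fix r :: real assume r: "0 < r" "ereal r < conv_radius (fps_nth f)"
  then have "summable (\<lambda>n. norm (fps_nth f n * r ^ n))"
    by (intro abs_summable_in_conv_radius) auto
  then have "summable (\<lambda>n. r * norm (fps_nth f n * r ^ n))"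
    by (rule summable_mult)
  then have "summable (\<lambda>n. fps_nth (fps_integral0 f) (Suc n) * r ^ Suc n)"
  proof (rule summable_comparison_test[rotated], intro exI allI impI)
    fix n
    have "norm (fps_nth f n * r ^ n) / real (Suc n) \<le> norm (fps_nth f n * r ^ n) / 1"
      by (intro divide_left_mono) auto
    then have "r * (norm (fps_nth f n * r ^ n) / real (Suc n)) \<le> r * norm (fps_nth f n * r ^ n)"
      using r by (intro mult_left_mono) auto
    then show "norm (fps_nth (fps_integral0 f) (Suc n) * r ^ Suc n)
        \<le> r * norm (fps_nth f n * r ^ n)"
      using r by (simp add: abs_mult field_simps del: of_nat_Suc)
  qed
  then show "summable (\<lambda>n. fps_nth (fps_integral0 f) n * of_real r ^ n)"
    by (subst (asm) summable_Suc_iff) simp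
qed

lemma fps_conv_radius_funpow_integral0_ge:
  fixes f :: "real fps"
  shows "fps_conv_radius f \<le> fps_conv_radius ((fps_integral0 ^^ j) f)"
  by (induction j) (auto intro: order_trans fps_conv_radius_integral0_ge)

lemma fps_nth_funpow_integral0:
  fixes f :: "real fps"
  shows "fps_nth ((fps_integral0 ^^ j) f) n =
    (if n < j then 0 else fps_nth f (n - j) * fact (n - j) / fact n)"
proof (induction j arbitrary: n)
  case (Suc j)
  show ?case
    by (cases n) (auto simp: Suc field_simps simp del: of_nat_Suc)
qed auto

lemma has_derivative_eval_funpow_integral0:
  fixes f :: "real fps"
  assumes "ereal \<bar>x\<bar> < fps_conv_radius f"
  shows "(eval_fps ((fps_integral0 ^^ Suc j) f) has_field_derivative
           eval_fps ((fps_integral0 ^^ j) f) x) (at x within S)"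
proof -
  have "ereal (norm x) < fps_conv_radius ((fps_integral0 ^^ Suc j) f)"
    using assms fps_conv_radius_funpow_integral0_ge[of f "Suc j"] by simp
  then have "(eval_fps ((fps_integral0 ^^ Suc j) f) has_field_derivative
     eval_fps (fps_deriv ((fps_integral0 ^^ Suc j) f)) x) (at x within S)"
    by (rule has_field_derivative_eval_fps)
  then show ?thesis by (simp add: fps_deriv_fps_integral)
qed

section \<open>Power series solutions of a Riccati equation\<close>

lemma fps_nth_two_mult: "fps_nth (2 * f) n = 2 * fps_nth (f :: real fps) n"
  by (simp add: numeral_fps_const)

lemma fps_nth_power2:
  "fps_nth (f ^ 2) n = (\<Sum>i=0..n. fps_nth f i * fps_nth (f :: real fps) (n - i))"
  by (simp add: power2_eq_square fps_mult_nth)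

text \<open>
  The recursion \<open>2 (m + 1) a\<^bsub>m+1\<^esub> = \<Sum>\<^bsub>i+j=m\<^esub> a\<^sub>i a\<^sub>j\<close> for \<open>m > 0\<close> has \<open>m + 1\<close> summands on the right,
  each at most \<open>2\<^bsup>-m\<^esup>\<close> by induction, so the bound \<open>2\<^bsup>-n\<^esup>\<close> reproduces itself. It is far from sharp for
  \<open>tan (x / 2)\<close>, whose series has radius \<open>\<pi>\<close>, but it gives the radius \<open>2 > \<pi> / 2\<close>, which
  suffices for an evaluation at \<open>\<pi> / 2\<close> and avoids complex analysis.
\<close>

lemma Riccati_fps_coeff_bound:
  fixes f :: "real fps"
  assumes "fps_nth f 0 = 0" and ode: "2 * fps_deriv f = 1 + f ^ 2"
  shows "\<bar>fps_nth f n\<bar> \<le> (1 / 2) ^ n"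
proof (induction n rule: less_induct)
  case (less n)
  show ?case
  proof (cases n)
    case 0
    then show ?thesis using assms(1) by simp
  next
    case (Suc m)
    have eq: "2 * (real (Suc m) * fps_nth f n) =
        (if m = 0 then 1 else 0) + (\<Sum>i=0..m. fps_nth f i * fps_nth f (m - i))"
      using arg_cong[OF ode, of "\<lambda>g. fps_nth g m"]
      by (simp add: Suc fps_nth_two_mult fps_nth_power2)
    show ?thesis
    proof (cases "m = 0")
      case True
      then show ?thesis using eq assms(1) Suc by simp
    next
      case False
      have "\<bar>\<Sum>i=0..m. fps_nth f i * fps_nth f (m - i)\<bar>
          \<le> (\<Sum>i=0..m. \<bar>fps_nth f i * fps_nth f (m - i)\<bar>)"
        by (rule sum_abs)
      also have "\<dots> \<le> (\<Sum>i=0..m. (1 / 2) ^ i * (1 / 2) ^ (m - i))"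
        unfolding abs_mult using Suc by (intro sum_mono mult_mono less.IH) auto
      also have "\<dots> = (\<Sum>i=0..m. (1 / 2) ^ m)"
        by (intro sum.cong) (auto simp flip: power_add)
      also have "\<dots> = real (Suc m) * (1 / 2) ^ m"
        by simp
      finally have "2 * (real (Suc m) * \<bar>fps_nth f n\<bar>) \<le> real (Suc m) * (1 / 2) ^ m"
        using arg_cong[OF eq, of abs] False by (simp add: abs_mult)
      then have "real (Suc m) * (2 * \<bar>fps_nth f n\<bar>) \<le> real (Suc m) * (1 / 2) ^ m"
        by (simp add: mult_ac)
      then show ?thesis
        using Suc by (subst (asm) mult_le_cancel_left_pos) (auto simp: field_simps)
    qed
  qed
qed

lemma Riccati_fps_conv_radius:
  fixes f :: "real fps"
  assumes "fps_nth f 0 = 0" and "2 * fps_deriv f = 1 + f ^ 2"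
  shows "2 \<le> fps_conv_radius f"
  unfolding fps_conv_radius_def
proof (rule conv_radius_geI_ex')
  fix r :: real assume r: "0 < r" "ereal r < 2"
  then have "r < 2"
    by simp
  show "summable (\<lambda>n. fps_nth f n * of_real r ^ n)"
  proof (rule summable_comparison_test, intro exI allI impI)
    show "norm (fps_nth f n * of_real r ^ n) \<le> (r / 2) ^ n" for n
      using mult_right_mono[OF Riccati_fps_coeff_bound[OF assms, of n], of "r ^ n"] r
      by (simp add: abs_mult power_divide)
    show "summable (\<lambda>n. (r / 2) ^ n)"
      using r \<open>r < 2\<close> by (intro summable_geometric) auto
  qed
qed

text \<open>
  For \<open>\<bar>x\<bar> < 2\<close> the sum \<open>y\<close> satisfies \<open>y' = (1 + y\<^sup>2) / 2\<close>, so \<open>arctan y\<close> has the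
  constant derivative \<open>1 / 2\<close>.
\<close>

lemma eval_Riccati_fps:
  fixes f :: "real fps"
  assumes f0: "fps_nth f 0 = 0" and ode: "2 * fps_deriv f = 1 + f ^ 2" and x: "\<bar>x\<bar> < 2"
  shows "eval_fps f x = tan (x / 2)"
proof -
  have rad: "ereal (norm y) < fps_conv_radius f" if "\<bar>y\<bar> < 2" for y :: real
  proof -
    have "ereal (norm y) < 2" using that by simp
    then show ?thesis using Riccati_fps_conv_radius[OF f0 ode] by order
  qed
  have deriv: "eval_fps (fps_deriv f) y = (1 + (eval_fps f y)\<^sup>2) / 2" if "\<bar>y\<bar> < 2" for y
  proof -
    have 1: "ereal (norm y) < fps_conv_radius (fps_deriv f)"
      using rad[OF that] fps_conv_radius_deriv[of f] by order
    have 2: "ereal (norm y) < fps_conv_radius (f ^ 2)"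
      using rad[OF that] fps_conv_radius_power[of f 2] by order
    have "eval_fps (2 * fps_deriv f) y = 2 * eval_fps (fps_deriv f) y"
      using 1 by (subst eval_fps_mult) auto
    moreover have "eval_fps (1 + f ^ 2) y = 1 + (eval_fps f y)\<^sup>2"
      using 2 rad[OF that] by (subst eval_fps_add) (auto simp: eval_fps_power)
    ultimately show ?thesis using ode by simp
  qed
  have "arctan (eval_fps f x) - x / 2 = arctan (eval_fps f 0) - 0 / 2"
  proof (rule DERIV_isconst3[of "-2" 2 x 0 "\<lambda>y. arctan (eval_fps f y) - y / 2"])
    fix y :: real assume "y \<in> {-2<..<2}"
    then have y: "\<bar>y\<bar> < 2" by auto
    have "1 + (eval_fps f y)\<^sup>2 > 0" by (simp add: add_pos_nonneg)
    then show "((\<lambda>y. arctan (eval_fps f y) - y / 2) has_real_derivative 0) (at y)"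
      by (auto intro!: derivative_eq_intros has_field_derivative_eval_fps[OF rad[OF y]]
            simp: deriv[OF y] field_simps)
  qed (use x in auto)
  then have "arctan (eval_fps f x) = x / 2"
    by (simp add: eval_fps_at_0 f0)
  then show ?thesis by (metis tan_arctan)
qed

section \<open>The Euler polynomials at 1 and the tangent\<close>

text \<open>
  Specialised to \<open>x = 1\<close>, the generating function of the Euler polynomials is
  \<open>2 e\<^sup>t / (e\<^sup>t + 1) = 1 + tanh (t / 2)\<close>; this is the series of \<open>tanh (t / 2)\<close>.
\<close>

definition tanh_half_fps :: "real fps" where
  "tanh_half_fps = Abs_fps (\<lambda>n. euler_poly n 1 / fact n) - 1"

text \<open>
  With \<open>e = e\<^sup>t\<close> the series is \<open>h = (e - 1) / (e + 1)\<close>. Differentiating the product form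
  \<open>(h + 1) (e + 1) = 2 e\<close> and using \<open>e' = e\<close> yields the equation multiplied by \<open>e + 1\<close>, which can be
  cancelled.
\<close>

lemma tanh_half_fps_Riccati: "2 * fps_deriv tanh_half_fps = 1 - tanh_half_fps ^ 2"
proof -
  define h where "h = tanh_half_fps"
  define e where "e = fps_exp (1::real)"
  have 1: "(h + 1) * (e + 1) = 2 * e"
    using euler_poly_generating_function[of 1] by (simp add: h_def e_def tanh_half_fps_def)
  have e': "fps_deriv e = e" by (simp add: e_def)
  have "fps_deriv ((h + 1) * (e + 1)) = fps_deriv (2 * e)"
    by (simp only: 1)
  then have 2: "fps_deriv h * (e + 1) + (h + 1) * e = 2 * e"
    by (simp add: e' add.commute)
  have "(2 * fps_deriv h) * (e + 1) = (1 - h ^ 2) * (e + 1)"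
    using 1 2 by algebra
  moreover have "e + 1 \<noteq> 0"
  proof
    assume "e + 1 = 0"
    then have "fps_nth (e + 1) 0 = 0" by simp
    then show False by (simp add: e_def)
  qed
  ultimately show ?thesis by (simp add: h_def)
qed

lemma tanh_half_fps_nth_0: "fps_nth tanh_half_fps 0 = 0"
  using arg_cong[OF euler_poly_generating_function[of 1], of "\<lambda>g. fps_nth g 0"]
  by (simp add: tanh_half_fps_def numeral_fps_const)

lemma tanh_half_fps_nth_Suc:
  "2 * (real (Suc n) * fps_nth tanh_half_fps (Suc n)) =
    (if n = 0 then 1 else 0) - (\<Sum>i=0..n. fps_nth tanh_half_fps i * fps_nth tanh_half_fps (n - i))"
  using arg_cong[OF tanh_half_fps_Riccati, of "\<lambda>g. fps_nth g n"]
  by (simp add: fps_nth_two_mult fps_nth_power2)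

text \<open>
  The Riccati equation makes \<open>h\<^sub>n\<close>, for even \<open>n > 0\<close>, a multiple of a sum of products
  \<open>h\<^sub>i h\<^sub>j\<close> with \<open>i + j = n - 1\<close> odd, and one of the two indices is then even.
\<close>

lemma tanh_half_fps_nth_even: "even n \<Longrightarrow> fps_nth tanh_half_fps n = 0"
proof (induction n rule: less_induct)
  case (less n)
  show ?case
  proof (cases n)
    case 0
    then show ?thesis by (simp add: tanh_half_fps_nth_0)
  next
    case (Suc m)
    have "fps_nth tanh_half_fps i * fps_nth tanh_half_fps (m - i) = 0" if "i \<in> {0..m}" for i
      using less.IH[of i] less.IH[of "m - i"] less.prems that Suc by (cases "even i") auto
    then have "(\<Sum>i=0..m. fps_nth tanh_half_fps i * fps_nth tanh_half_fps (m - i)) = 0"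
      by (rule sum.neutral[OF ballI])
    then show ?thesis
      using tanh_half_fps_nth_Suc[of m] less.prems Suc by (cases "m = 0") auto
  qed
qed

text \<open>
  Since \<open>tan z = - \<i> tanh (\<i> z)\<close>, the series of \<open>tan (t / 2)\<close> arises from the odd series of
  \<open>tanh (t / 2)\<close> by alternating the signs of its odd coefficients. Carrying this out on
  coefficients keeps everything over the reals.
\<close>

definition tan_half_fps :: "real fps" where
  "tan_half_fps = Abs_fps (\<lambda>n. (-1) ^ (n div 2) * fps_nth tanh_half_fps n)"

text \<open>
  The twist changes the sign of the quadratic term: for \<open>i + j = n\<close> with \<open>i\<close>, \<open>j\<close> both odd, the
  signs of the factors multiply to \<open>(-1)\<^bsup>n/2 - 1\<^esup>\<close>, the opposite of the sign \<open>(-1)\<^bsup>n/2\<^esup>\<close> attached to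
  the coefficient of \<open>t\<^bsup>n+1\<^esup>\<close>; all other products vanish.
\<close>

lemma tan_half_fps_Riccati: "2 * fps_deriv tan_half_fps = 1 + tan_half_fps ^ 2"
proof (rule fps_ext)
  fix n
  let ?h = "fps_nth tanh_half_fps" and ?a = "fps_nth tan_half_fps"
  have prod: "?a i * ?a (n - i) = - ((-1) ^ (Suc n div 2) * (?h i * ?h (n - i)))"
    if "i \<in> {0..n}" for i
  proof (cases "odd i \<and> odd (n - i)")
    case True
    then obtain p q where pq: "i = 2 * p + 1" "n - i = 2 * q + 1"
      by (meson oddE)
    then have "n = 2 * (p + q + 1)"
      using that by auto
    then have "Suc n div 2 = p + q + 1"
      by simp
    moreover have "i div 2 = p" "(n - i) div 2 = q"
      by (simp add: pq(1)) (simp add: pq(2))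
    ultimately show ?thesis
      by (simp add: tan_half_fps_def power_add)
  next
    case False
    then show ?thesis
      by (auto simp: tan_half_fps_def tanh_half_fps_nth_even)
  qed
  have "fps_nth (2 * fps_deriv tan_half_fps) n =
      (-1) ^ (Suc n div 2) * (2 * (real (Suc n) * ?h (Suc n)))"
    by (simp add: fps_nth_two_mult tan_half_fps_def)
  also have "\<dots> = (if n = 0 then 1 else 0) - (-1) ^ (Suc n div 2) * (\<Sum>i=0..n. ?h i * ?h (n - i))"
    unfolding tanh_half_fps_nth_Suc by (simp add: algebra_simps)
  also have "\<dots> = (if n = 0 then 1 else 0) + (\<Sum>i=0..n. ?a i * ?a (n - i))"
    by (simp add: prod sum_negf sum_distrib_left)
  also have "\<dots> = fps_nth (1 + tan_half_fps ^ 2) n"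
    by (simp add: fps_nth_power2)
  finally show "fps_nth (2 * fps_deriv tan_half_fps) n = fps_nth (1 + tan_half_fps ^ 2) n" .
qed

lemma tan_half_fps_nth_0: "fps_nth tan_half_fps 0 = 0"
  by (simp add: tan_half_fps_def tanh_half_fps_nth_0)

lemma tan_half_fps_nth_even: "even n \<Longrightarrow> fps_nth tan_half_fps n = 0"
  by (simp add: tan_half_fps_def tanh_half_fps_nth_even)

lemma tan_half_fps_nth_odd:
  "fps_nth tan_half_fps (2 * m + 1) = (-1) ^ m * euler_poly (2 * m + 1) 1 / fact (2 * m + 1)"
  by (simp add: tan_half_fps_def tanh_half_fps_def)

section \<open>Iterated primitives of the tangent\<close>

text \<open>
  The \<open>j\<close>-fold iterated primitive of \<open>tan (x / 2)\<close>, each primitive vanishing at \<open>0\<close>. Being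
  defined by a power series, it is used only for \<open>\<bar>x\<bar> < 2\<close>, where the coefficient bound guarantees
  convergence.
\<close>

definition tan_integral :: "nat \<Rightarrow> real \<Rightarrow> real" where
  "tan_integral j = eval_fps ((fps_integral0 ^^ j) tan_half_fps)"

lemma ereal_less_tan_half_fps_radius: "\<bar>x\<bar> < 2 \<Longrightarrow> ereal \<bar>x\<bar> < fps_conv_radius tan_half_fps"
proof -
  assume "\<bar>x\<bar> < 2"
  then have "ereal \<bar>x\<bar> < 2" by simp
  then show ?thesis
    using Riccati_fps_conv_radius[OF tan_half_fps_nth_0 tan_half_fps_Riccati] by order
qed

lemma tan_integral_0: "\<bar>x\<bar> < 2 \<Longrightarrow> tan_integral 0 x = tan (x / 2)"
  by (simp add: tan_integral_def eval_Riccati_fps[OF tan_half_fps_nth_0 tan_half_fps_Riccati])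

lemma tan_integral_Suc_at_0: "tan_integral (Suc j) 0 = 0"
  by (simp add: tan_integral_def eval_fps_at_0)

lemma has_derivative_tan_integral:
  "\<bar>x\<bar> < 2 \<Longrightarrow> (tan_integral (Suc j) has_field_derivative tan_integral j x) (at x within S)"
  unfolding tan_integral_def
  by (intro has_derivative_eval_funpow_integral0 ereal_less_tan_half_fps_radius)

lemma tan_integral_sums:
  assumes "\<bar>x\<bar> < 2"
  shows "(\<lambda>m. (-1) ^ m * euler_poly (2 * m + 1) 1 * x ^ (2 * m + 1 + j) / fact (2 * m + 1 + j))
           sums tan_integral j x"
proof -
  let ?F = "(fps_integral0 ^^ j) tan_half_fps"
  let ?g = "\<lambda>m. 2 * m + 1 + j"
  have "ereal (norm x) < fps_conv_radius ?F"
    using ereal_less_tan_half_fps_radius[OF assms]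
      fps_conv_radius_funpow_integral0_ge[of tan_half_fps j] by simp
  then have "(\<lambda>n. fps_nth ?F n * x ^ n) sums tan_integral j x"
    unfolding tan_integral_def by (rule sums_eval_fps)
  moreover have "fps_nth ?F n * x ^ n = 0" if "n \<notin> range ?g" for n
  proof (cases "n < j")
    case False
    have "even (n - j)"
    proof (rule ccontr)
      assume "odd (n - j)"
      then obtain m where "n - j = 2 * m + 1" by (rule oddE)
      then have "n = ?g m" using False by simp
      then show False using that by blast
    qed
    then show ?thesis
      by (simp add: fps_nth_funpow_integral0 tan_half_fps_nth_even del: even_diff_nat)
  qed (simp add: fps_nth_funpow_integral0)
  ultimately have "(\<lambda>m. fps_nth ?F (?g m) * x ^ ?g m) sums tan_integral j x"
    by (subst sums_mono_reindex) (auto simp: strict_mono_def)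
  moreover have "fps_nth ?F (?g m) =
      (-1) ^ m * euler_poly (2 * m + 1) 1 / fact (?g m)" for m
    by (simp add: fps_nth_funpow_integral0 tan_half_fps_nth_odd[simplified])
  ultimately show ?thesis by simp
qed

section \<open>Iterated primitives of the sine\<close>

text \<open>
  The \<open>j\<close>-fold iterated primitive of \<open>sin (w x)\<close> for \<open>w \<noteq> 0\<close>, each primitive vanishing at \<open>0\<close>. The shift
  by \<open>j \<pi> / 2\<close> describes the primitives \<open>- cos\<close>, \<open>- sin\<close>, \<open>cos\<close>, \<open>sin\<close> uniformly; the sum
  is the polynomial collecting the constants of integration.
\<close>

definition sin_integral :: "nat \<Rightarrow> real \<Rightarrow> real \<Rightarrow> real" where
  "sin_integral j w x = sin (w * x - real j * (pi / 2)) / w ^ j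
     - (\<Sum>i=1..j. sin (- (real i * (pi / 2))) / w ^ i * (x ^ (j - i) / fact (j - i)))"

lemma sin_integral_0: "sin_integral 0 w x = sin (w * x)"
  by (simp add: sin_integral_def)

lemma sin_integral_Suc_at_0: "sin_integral (Suc j) w 0 = 0"
proof -
  have "(\<Sum>i=1..j. sin (- (real i * (pi / 2))) / w ^ i * (0 ^ (Suc j - i) / fact (Suc j - i))) = 0"
    by (intro sum.neutral) auto
  then show ?thesis
    by (simp add: sin_integral_def)
qed

lemma has_derivative_sin_integral:
  assumes "w \<noteq> 0"
  shows "(sin_integral (Suc j) w has_field_derivative sin_integral j w x) (at x within S)"
proof -
  have shift: "cos (w * x - real (Suc j) * (pi / 2)) = sin (w * x - real j * (pi / 2))"
  proof -
    have "w * x - real (Suc j) * (pi / 2) = (w * x - real j * (pi / 2)) - pi / 2"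
      by (simp add: algebra_simps)
    moreover have "cos (a - pi / 2) = sin a" for a
      by (simp add: cos_diff)
    ultimately show ?thesis
      by (simp only:)
  qed
  have "((\<lambda>x. sin (w * x - real (Suc j) * (pi / 2)) / w ^ Suc j) has_field_derivative
          sin (w * x - real j * (pi / 2)) / w ^ j) (at x within S)"
    using assms shift by (auto intro!: derivative_eq_intros simp del: of_nat_Suc)
  moreover have "((\<lambda>x. sin (- (real i * (pi / 2))) / w ^ i * (x ^ (Suc j - i) / fact (Suc j - i)))
      has_field_derivative sin (- (real i * (pi / 2))) / w ^ i * (x ^ (j - i) / fact (j - i)))
      (at x within S)" if "i \<in> {1..j}" for i
  proof -
    have *: "Suc j - i = Suc (j - i)" using that by auto
    have "((\<lambda>x. x ^ Suc (j - i) / fact (Suc (j - i))) has_field_derivative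
        x ^ (j - i) / fact (j - i)) (at x within S)"
      by (auto intro!: derivative_eq_intros simp del: of_nat_Suc power_Suc simp: field_simps)
    then show ?thesis unfolding * by (rule DERIV_cmult)
  qed
  ultimately have "((\<lambda>x. sin (w * x - real (Suc j) * (pi / 2)) / w ^ Suc j
     - ((\<Sum>i=1..j. sin (- (real i * (pi / 2))) / w ^ i * (x ^ (Suc j - i) / fact (Suc j - i)))
        + sin (- (real (Suc j) * (pi / 2))) / w ^ Suc j)) has_field_derivative
     (sin (w * x - real j * (pi / 2)) / w ^ j
      - ((\<Sum>i=1..j. sin (- (real i * (pi / 2))) / w ^ i * (x ^ (j - i) / fact (j - i))) + 0)))
     (at x within S)"
    by (intro DERIV_diff DERIV_add DERIV_sum DERIV_const)
  then show ?thesis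
    by (simp add: sin_integral_def[abs_def])
qed

section \<open>Integrated Fourier series of the tangent\<close>

text \<open>
  Up to sign, the sum is the conjugate Dirichlet kernel at \<open>x + \<pi>\<close>: the products \<open>2 cos (x / 2) sin (m x)\<close> split into
  \<open>sin ((m + 1/2) x) + sin ((m - 1/2) x)\<close> and the alternating sum telescopes.
\<close>

lemma alternating_sin_sum:
  "2 * cos (x / 2) * (\<Sum>n<N. (-1) ^ n * sin (real (Suc n) * x)) =
     sin (x / 2) - (-1) ^ N * sin ((real N + 1 / 2) * x)"
proof (induction N)
  case (Suc N)
  have 1: "(real N + 1 / 2) * x = real (Suc N) * x - x / 2"
    and 2: "(real (Suc N) + 1 / 2) * x = real (Suc N) * x + x / 2"
    by (simp_all add: field_simps)
  have "2 * cos (x / 2) * (\<Sum>n<Suc N. (-1) ^ n * sin (real (Suc n) * x)) =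
    sin (x / 2) - (-1) ^ N * sin ((real N + 1 / 2) * x)
      + (-1) ^ N * (2 * cos (x / 2) * sin (real (Suc N) * x))"
    by (simp only: sum.lessThan_Suc distrib_left Suc.IH) simp
  also have "\<dots> = sin (x / 2) - (-1) ^ Suc N * sin ((real (Suc N) + 1 / 2) * x)"
    unfolding 1 2 sin_diff sin_add by (simp add: algebra_simps)
  finally show ?case .
qed simp

text \<open>
  What is left of the \<open>j\<close>-th primitive of \<open>tan (x / 2)\<close> after subtracting the \<open>j\<close>-th primitives of
  the first \<open>N\<close> terms of the formal Fourier series \<open>2 \<Sum>\<^bsub>m\<ge>1\<^esub> (-1)\<^bsup>m-1\<^esup> sin (m x)\<close> of \<open>tan (x / 2)\<close>. For
  \<open>j = 0\<close> it tends to \<open>0\<close> at no point of \<open>(0, \<pi> / 2]\<close>; for \<open>j > 0\<close> it tends to \<open>0\<close> on all of \<open>[0, \<pi> / 2]\<close>.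
\<close>

definition fourier_remainder :: "nat \<Rightarrow> nat \<Rightarrow> real \<Rightarrow> real" where
  "fourier_remainder N j x = tan_integral j x - 2 * (\<Sum>n<N. (-1) ^ n * sin_integral j (real (Suc n)) x)"

lemma abs_less_2_if_le_pi_half: "x \<in> {0..pi / 2} \<Longrightarrow> \<bar>x\<bar> < 2"
  using pi_half_less_two by auto

lemma cos_half_squared_ge:
  assumes "x \<in> {0..pi / 2}"
  shows "cos (x / 2) > 0" "1 / 2 \<le> (cos (x / 2))\<^sup>2"
proof -
  show "cos (x / 2) > 0"
    using assms pi_gt_zero unfolding atLeastAtMost_iff by (intro cos_gt_zero_pi) linarith+
  have "0 \<le> cos x" using assms by (intro cos_ge_zero) auto
  then show "1 / 2 \<le> (cos (x / 2))\<^sup>2"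
    using cos_double_cos[of "x / 2"] by simp
qed

lemma fourier_remainder_0:
  assumes "x \<in> {0..pi / 2}"
  shows "fourier_remainder N 0 x = (-1) ^ N * sin ((real N + 1 / 2) * x) / cos (x / 2)"
proof -
  have "fourier_remainder N 0 x =
      sin (x / 2) / cos (x / 2) - 2 * (\<Sum>n<N. (-1) ^ n * sin (real (Suc n) * x))"
    unfolding fourier_remainder_def tan_integral_0[OF abs_less_2_if_le_pi_half[OF assms]] sin_integral_0 tan_def
    by (rule refl)
  also have "\<dots> = (sin (x / 2) - 2 * cos (x / 2) * (\<Sum>n<N. (-1) ^ n * sin (real (Suc n) * x)))
      / cos (x / 2)"
    using cos_half_squared_ge(1)[OF assms] by (simp add: field_simps)
  finally show ?thesis
    by (simp only: alternating_sin_sum) simp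
qed

lemma fourier_remainder_Suc_at_0: "fourier_remainder N (Suc j) 0 = 0"
  by (simp add: fourier_remainder_def tan_integral_Suc_at_0 sin_integral_Suc_at_0)

lemma has_derivative_remainder:
  assumes "x \<in> {0..pi / 2}"
  shows "(fourier_remainder N (Suc j) has_field_derivative fourier_remainder N j x) (at x within S)"
  unfolding fourier_remainder_def[abs_def]
  by (intro DERIV_diff DERIV_cmult DERIV_sum has_derivative_tan_integral
        has_derivative_sin_integral abs_less_2_if_le_pi_half[OF assms]) simp

text \<open>
  The remainder for \<open>j = 0\<close> is bounded but oscillates with frequency \<open>w = N + 1/2\<close>. Integrating by
  parts gains a factor \<open>1 / w\<close>: with \<open>g\<close> the boundary term, the derivative \<open>d\<close> of the remainder for
  \<open>j = 1\<close> plus \<open>g\<close> is already of order \<open>1 / w\<close>, because \<open>1 / cos (x / 2)\<close> has a bounded derivative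
  on \<open>[0, \<pi> / 2]\<close>.
\<close>

lemma fourier_remainder_1_bound:
  assumes x: "x \<in> {0..pi / 2}"
  shows "\<bar>fourier_remainder N 1 x\<bar> \<le> 6 / (real N + 1 / 2)"
proof -
  define w where "w = real N + 1 / 2"
  have w: "w > 0" by (simp add: w_def)
  define s :: real where "s = (-1) ^ N"
  have s: "\<bar>s\<bar> = 1" by (simp add: s_def power_abs)
  define g where "g = (\<lambda>y. s * (cos (w * y) / (w * cos (y / 2))))"
  define d where "d = (\<lambda>y. s * (cos (w * y) * sin (y / 2) / (2 * w * (cos (y / 2))\<^sup>2)))"
  \<comment> \<open>Differentiating the cosine in \<open>g\<close> reproduces the remainder for \<open>j = 0\<close> with the opposite sign.\<close>
  have der: "((\<lambda>y. fourier_remainder N 1 y + g y) has_field_derivative d y) (at y within {0..pi / 2})"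
    if "y \<in> {0..pi / 2}" for y
  proof -
    note c = cos_half_squared_ge(1)[OF that]
    have "(g has_field_derivative
        s * (((- sin (w * y) * w) * (w * cos (y / 2))
          - cos (w * y) * (w * (- sin (y / 2) * (1 / 2)))) / (w * cos (y / 2))\<^sup>2))
        (at y within {0..pi / 2})"
    proof -
      have "((\<lambda>y. cos (w * y)) has_field_derivative - sin (w * y) * w) (at y within {0..pi / 2})"
        and "((\<lambda>y. w * cos (y / 2)) has_field_derivative w * (- sin (y / 2) * (1 / 2)))
               (at y within {0..pi / 2})"
        by (auto intro!: derivative_eq_intros)
      moreover have "w * cos (y / 2) \<noteq> 0"
        using c w by simp
      ultimately show ?thesis
        unfolding g_def power2_eq_square by (rule DERIV_cmult[OF DERIV_divide])
    qed
    also have "s * (((- sin (w * y) * w) * (w * cos (y / 2))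
          - cos (w * y) * (w * (- sin (y / 2) * (1 / 2)))) / (w * cos (y / 2))\<^sup>2)
        = s * (- sin (w * y) / cos (y / 2)
          + cos (w * y) * sin (y / 2) / (2 * w * (cos (y / 2))\<^sup>2))"
    proof -
      have "(- S * w) * (w * c) / (w * c)\<^sup>2 = - S / c" if "c \<noteq> 0" for S c :: real
        using w that by (simp add: power2_eq_square)
      moreover have "C * (w * (- t * (1 / 2))) / (w * c)\<^sup>2 = - (C * t / (2 * w * c\<^sup>2))"
        if "c \<noteq> 0" for C t c :: real
        using w that by (simp add: power2_eq_square)
      ultimately show ?thesis
        using c by (simp only: diff_divide_distrib less_imp_neq[THEN not_sym] not_False_eq_True) simp
    qed
    also have "\<dots> = d y - fourier_remainder N 0 y"
      unfolding fourier_remainder_0[OF that] d_def s_def[symmetric] w_def[symmetric]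
      by (simp add: algebra_simps)
    finally have "(g has_field_derivative d y - fourier_remainder N 0 y) (at y within {0..pi / 2})" .
    from DERIV_add[OF has_derivative_remainder[OF that, of N 0] this] show ?thesis
      by simp
  qed
  have "\<bar>d y\<bar> \<le> 1 / w" if "y \<in> {0..pi / 2}" for y
  proof -
    note c = cos_half_squared_ge[OF that]
    have "\<bar>cos (w * y) * sin (y / 2)\<bar> \<le> 1"
      unfolding abs_mult by (intro mult_le_one) auto
    moreover have "2 * w * (cos (y / 2))\<^sup>2 \<ge> w"
      using mult_left_mono[OF c(2), of "2 * w"] w by simp
    moreover have "\<bar>d y\<bar> = \<bar>cos (w * y) * sin (y / 2)\<bar> / (2 * w * (cos (y / 2))\<^sup>2)"
      using w s by (simp add: d_def abs_mult)
    ultimately show ?thesis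
      using w by (auto intro!: frac_le)
  qed
  then have "norm ((fourier_remainder N 1 x + g x) - (fourier_remainder N 1 0 + g 0)) \<le> 1 / w * norm (x - 0)"
    using x by (intro field_differentiable_bound[of "{0..pi / 2}" _ d] der) auto
  also have "\<dots> \<le> 1 / w * 2"
    using w abs_less_2_if_le_pi_half[OF x] by (intro mult_left_mono) auto
  finally have 1: "\<bar>fourier_remainder N 1 x + g x - g 0\<bar> \<le> 2 / w"
    using fourier_remainder_Suc_at_0[of N 0] by simp
  have g: "\<bar>g y\<bar> \<le> 2 / w" if "y \<in> {0..pi / 2}" for y
  proof -
    note c = cos_half_squared_ge[OF that]
    have "(cos (y / 2))\<^sup>2 \<le> cos (y / 2)"
      using c(1) by (simp add: power2_eq_square mult_left_le)
    then have "w / 2 \<le> w * cos (y / 2)"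
      using c w by simp
    then have "\<bar>cos (w * y)\<bar> / (w * cos (y / 2)) \<le> 1 / (w / 2)"
      using w by (intro frac_le) auto
    then show ?thesis
      using w c s by (simp add: g_def abs_mult)
  qed
  have "\<bar>fourier_remainder N 1 x\<bar> \<le> 2 / w + 2 / w + 2 / w"
    using 1 g[OF x] g[of 0] by (simp add: abs_le_iff)
  then show ?thesis by (simp add: w_def)
qed

text \<open>
  Each further integration over a subinterval of \<open>[0, \<pi> / 2]\<close> costs at most the factor \<open>\<pi> / 2 < 2\<close>
  by the mean value theorem.
\<close>

lemma fourier_remainder_Suc_bound:
  assumes "x \<in> {0..pi / 2}"
  shows "\<bar>fourier_remainder N (Suc j) x\<bar> \<le> 6 / (real N + 1 / 2) * 2 ^ j"
  using assms
proof (induction j arbitrary: x)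
  case 0
  then show ?case using fourier_remainder_1_bound[of x N] by simp
next
  case (Suc j)
  let ?B = "6 / (real N + 1 / 2) * 2 ^ j"
  have "norm (fourier_remainder N (Suc (Suc j)) x - fourier_remainder N (Suc (Suc j)) 0) \<le> ?B * norm (x - 0)"
    using Suc.prems Suc.IH
    by (intro field_differentiable_bound[of "{0..pi / 2}" _ "fourier_remainder N (Suc j)"]
          has_derivative_remainder) auto
  also have "\<dots> \<le> ?B * 2"
    using abs_less_2_if_le_pi_half[OF Suc.prems] by (intro mult_left_mono) auto
  finally show ?case by (simp add: fourier_remainder_Suc_at_0 mult_ac)
qed

lemma tan_integral_Fourier_sums:
  assumes "x \<in> {0..pi / 2}"
  shows "(\<lambda>n. (-1) ^ n * sin_integral (Suc j) (real (Suc n)) x) sums (tan_integral (Suc j) x / 2)"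
proof -
  have lim: "(\<lambda>N. 6 / (real N + 1 / 2) * 2 ^ j) \<longlonglongrightarrow> 0"
    by real_asymp
  have "(\<lambda>N. fourier_remainder N (Suc j) x) \<longlonglongrightarrow> 0"
    by (rule Lim_null_comparison[OF _ lim]) (use fourier_remainder_Suc_bound[OF assms] in auto)
  then have "(\<lambda>N. (tan_integral (Suc j) x - fourier_remainder N (Suc j) x) / 2)
      \<longlonglongrightarrow> (tan_integral (Suc j) x - 0) / 2"
    by (intro tendsto_intros) auto
  then show ?thesis
    by (simp add: sums_def fourier_remainder_def)
qed

section \<open>Evaluation at half of pi\<close>

lemma sin_neg_odd_pi_half: "sin (- (real (2 * m + 1) * (pi / 2))) = - ((-1) ^ m)"
proof -
  have "real (2 * m + 1) * (pi / 2) = pi / 2 + real m * pi"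
    by (simp add: field_simps)
  then have "sin (real (2 * m + 1) * (pi / 2)) = sin (pi / 2 + real m * pi)"
    by (rule arg_cong)
  also have "\<dots> = (-1) ^ m"
    by (simp add: sin_add)
  finally show ?thesis
    by (simp only: sin_minus)
qed

lemma sum_odd_even_split:
  fixes f :: "nat \<Rightarrow> real"
  shows "(\<Sum>i=1..2 * k. f i) = (\<Sum>m<k. f (2 * m + 1)) + (\<Sum>m<k. f (2 * m + 2))"
  by (induction k) (auto simp: algebra_simps)

text \<open>
  For an even number of integrations only the constants of odd index survive,
  as \<open>sin (i \<pi> / 2) = 0\<close> for even \<open>i\<close>; they carry the odd powers of \<open>1 / w\<close> that
  produce \<open>ln 2\<close> and the values of the zeta function at odd integers.
\<close>

lemma sin_integral_even:
  assumes "w \<noteq> 0"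
  shows "sin_integral (2 * k) w x = (-1) ^ k * sin (w * x) / w ^ (2 * k)
    + (\<Sum>m<k. (-1) ^ m * (x ^ (2 * k - 2 * m - 1) / fact (2 * k - 2 * m - 1)) * (1 / w ^ (2 * m + 1)))"
proof -
  have 1: "sin (w * x - real (2 * k) * (pi / 2)) = (-1) ^ k * sin (w * x)"
    by (simp add: sin_diff)
  have "sin (- (real (2 * m + 2) * (pi / 2))) = 0" for m
  proof -
    have "real (2 * m + 2) * (pi / 2) = real (Suc m) * pi" by (simp add: field_simps)
    then show ?thesis by (simp only: sin_minus sin_npi minus_zero)
  qed
  then show ?thesis
    unfolding sin_integral_def sum_odd_even_split 1 sin_neg_odd_pi_half
    by (simp add: sum_negf mult.commute[of "fact _"])
qed

text \<open>
  At \<open>x = \<pi> / 2\<close> the sines select the odd frequencies \<open>2 j + 1\<close> with sign \<open>(-1)\<^sup>j\<close>. The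
  factor \<open>(-1)\<^sup>n\<close> is then \<open>1\<close> because these frequencies are \<open>n + 1\<close> with \<open>n = 2 j\<close>.
\<close>

lemma dirichlet_beta_sums:
  assumes "s > 0"
  shows "(\<lambda>n. (-1) ^ n * (sin (real (Suc n) * (pi / 2)) / real (Suc n) ^ s)) sums dirichlet_beta (real s)"
proof -
  let ?f = "\<lambda>n. (-1) ^ n * (sin (real (Suc n) * (pi / 2)) / real (Suc n) ^ s)"
  let ?g = "\<lambda>j::nat. 2 * j"
  have "(\<lambda>j. (-1) ^ j / real (2 * j + 1) powr real s) sums dirichlet_beta (real s)"
    unfolding dirichlet_beta_def using assms by (intro summable_sums summable_dirichlet_beta) simp
  moreover have "(-1) ^ j / real (2 * j + 1) powr real s = ?f (?g j)" for j
    using sin_neg_odd_pi_half[of j] by (simp add: powr_realpow del: of_nat_mult)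
  ultimately have "(\<lambda>j. ?f (?g j)) sums dirichlet_beta (real s)"
    by simp
  moreover have "?f n = 0" if "n \<notin> range ?g" for n
  proof -
    have "odd n" using that by (metis evenE rangeI)
    then obtain m where "n = 2 * m + 1" by (rule oddE)
    then have "real (Suc n) * (pi / 2) = real (Suc m) * pi" by (simp add: field_simps)
    then show ?thesis by (simp only: sin_npi div_0 mult_zero_right)
  qed
  ultimately show ?thesis
    by (subst (asm) sums_mono_reindex) (auto simp: strict_mono_def)
qed

text \<open>
  Subtract from the zeta series twice its terms over the even integers, which
  amount to \<open>2 \<sqdot> 2\<^bsup>-s\<^esup> \<zeta>(s)\<close>.
\<close>

lemma dirichlet_eta_sums:
  assumes "s > 1"
  shows "(\<lambda>n. (-1) ^ n / real (Suc n) ^ s) sums ((1 - 1 / 2 ^ (s - 1)) * riemann_zeta (real s))"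
proof -
  let ?z = "riemann_zeta (real s)"
  let ?f = "\<lambda>n. if odd n then 2 / real (Suc n) ^ s else 0"
  let ?g = "\<lambda>j::nat. 2 * j + 1"
  have z: "(\<lambda>n. 1 / real (Suc n) ^ s) sums ?z"
    using summable_sums[OF summable_riemann_zeta[of "real s"]] assms
    by (simp add: riemann_zeta_def powr_realpow)
  have "(\<lambda>j. 1 / 2 ^ (s - 1) * (1 / real (Suc j) ^ s)) sums (1 / 2 ^ (s - 1) * ?z)"
    by (intro sums_mult z)
  moreover have "1 / 2 ^ (s - 1) * (1 / real (Suc j) ^ s) = ?f (?g j)" for j
  proof -
    have "real (Suc (2 * j + 1)) = 2 * real (Suc j)" by simp
    then have "?f (?g j) = 2 / (2 * real (Suc j)) ^ s" by simp
    also have "\<dots> = 2 / (2 ^ s * real (Suc j) ^ s)" by (simp only: power_mult_distrib)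
    also have "(2::real) ^ s = 2 * 2 ^ (s - 1)"
      using assms by (cases s) auto
    finally show ?thesis by simp
  qed
  ultimately have "(\<lambda>j. ?f (?g j)) sums (1 / 2 ^ (s - 1) * ?z)"
    by simp
  moreover have "?f n = 0" if "n \<notin> range ?g" for n
  proof -
    have "even n" using that by (metis oddE rangeI)
    then show ?thesis by simp
  qed
  ultimately have "?f sums (1 / 2 ^ (s - 1) * ?z)"
    by (subst (asm) sums_mono_reindex) (auto simp: strict_mono_def)
  from sums_diff[OF z this]
  have "(\<lambda>n. 1 / real (Suc n) ^ s - ?f n) sums ((1 - 1 / 2 ^ (s - 1)) * ?z)"
    by (simp add: algebra_simps)
  moreover have "1 / real (Suc n) ^ s - ?f n = (-1) ^ n / real (Suc n) ^ s" for n
    by (auto simp: field_simps)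
  ultimately show ?thesis by simp
qed

text \<open>
  Summing the Fourier terms over the frequencies separates them into the beta series
  and, for each \<open>m < k\<close>, an alternating series with exponent \<open>2 m + 1\<close>; its sum is
  \<open>ln 2\<close> for \<open>m = 0\<close> and the eta value \<open>(1 - 2\<^bsup>-2m\<^esup>) \<zeta>(2m + 1)\<close> otherwise.
\<close>

lemma tan_integral_even_pi_half:
  assumes "k > 0"
  shows "tan_integral (2 * k) (pi / 2) / 2 = (-1) ^ k * dirichlet_beta (real (2 * k))
    + (pi / 2) ^ (2 * k - 1) / fact (2 * k - 1) * ln 2
    + (\<Sum>m=1..k - 1. (-1) ^ m * ((pi / 2) ^ (2 * k - 2 * m - 1) / fact (2 * k - 2 * m - 1))
         * ((1 - 1 / 2 ^ (2 * m)) * riemann_zeta (real (2 * m + 1))))"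
proof -
  let ?c = "\<lambda>m. (-1) ^ m * ((pi / 2) ^ (2 * k - 2 * m - 1) / fact (2 * k - 2 * m - 1)) :: real"
  define e where "e = (\<lambda>m. if m = 0 then ln 2 else (1 - 1 / 2 ^ (2 * m)) * riemann_zeta (real (2 * m + 1)))"
  have e: "(\<lambda>n. (-1) ^ n / real (Suc n) ^ (2 * m + 1)) sums e m" for m
    using alternating_harmonic_series_sums dirichlet_eta_sums[of "2 * m + 1"]
    by (cases "m = 0") (auto simp: e_def)
  have "(\<lambda>n. (-1) ^ k * ((-1) ^ n * (sin (real (Suc n) * (pi / 2)) / real (Suc n) ^ (2 * k)))
      + (\<Sum>m<k. ?c m * ((-1) ^ n / real (Suc n) ^ (2 * m + 1))))
      sums ((-1) ^ k * dirichlet_beta (real (2 * k)) + (\<Sum>m<k. ?c m * e m))"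
    using assms by (intro sums_add sums_mult sums_sum dirichlet_beta_sums e) auto
  moreover have "(-1) ^ k * ((-1) ^ n * (sin (real (Suc n) * (pi / 2)) / real (Suc n) ^ (2 * k)))
      + (\<Sum>m<k. ?c m * ((-1) ^ n / real (Suc n) ^ (2 * m + 1)))
      = (-1) ^ n * sin_integral (2 * k) (real (Suc n)) (pi / 2)" for n
    by (subst sin_integral_even) (simp_all add: distrib_left sum_distrib_left mult_ac)
  ultimately have "(\<lambda>n. (-1) ^ n * sin_integral (2 * k) (real (Suc n)) (pi / 2))
      sums ((-1) ^ k * dirichlet_beta (real (2 * k)) + (\<Sum>m<k. ?c m * e m))"
    by simp
  moreover have "(\<lambda>n. (-1) ^ n * sin_integral (2 * k) (real (Suc n)) (pi / 2))
      sums (tan_integral (2 * k) (pi / 2) / 2)"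
    using tan_integral_Fourier_sums[of "pi / 2" "2 * k - 1"] assms by simp
  ultimately have "tan_integral (2 * k) (pi / 2) / 2 =
      (-1) ^ k * dirichlet_beta (real (2 * k)) + (\<Sum>m<k. ?c m * e m)"
    by (rule sums_unique2[symmetric])
  also have "(\<Sum>m<k. ?c m * e m) = ?c 0 * e 0 + (\<Sum>m=1..k - 1. ?c m * e m)"
  proof -
    have "{..<k} = insert 0 {1..k - 1}" using assms by auto
    then show ?thesis by simp
  qed
  also have "(\<Sum>m=1..k - 1. ?c m * e m) =
      (\<Sum>m=1..k - 1. ?c m * ((1 - 1 / 2 ^ (2 * m)) * riemann_zeta (real (2 * m + 1))))"
    by (intro sum.cong) (auto simp: e_def)
  finally show ?thesis by (simp add: e_def)
qed

text \<open>
  The series over the Euler polynomials is the power series of \<open>tan_integral (2 * k)\<close> at \<open>\<pi> / 2\<close>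
  with the common factor \<open>(\<pi> / 2)\<^bsup>2k+1\<^esup>\<close> removed; it remains to solve the Fourier evaluation of the
  same number for the beta value.
\<close>

theorem theorem1:
  fixes k :: nat
  assumes "k > 0"
  shows "summable (\<lambda>m. (-1) ^ m * (pi ^ (2 * m) * euler_poly (2 * m + 1) 1)
             / (fact (2 * m + 2 * k + 1) * 2 ^ (2 * m))) \<and>
    dirichlet_beta (real (2 * k)) =
      (-1) ^ (k + 1) * ((pi / 2) ^ (2 * k - 1) / fact (2 * k - 1)) * ln 2
      - (-1) ^ k * (\<Sum>m = 1..k - 1.
            ((-1) ^ m * (pi / 2) ^ (2 * k - 2 * m - 1) / fact (2 * k - 2 * m - 1))
            * (1 - 1 / 2 ^ (2 * m)) * riemann_zeta (real (2 * m + 1)))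
      + (-1) ^ k * (pi ^ (2 * k + 1) / 2 ^ (2 * k + 2))
          * (\<Sum>m. (-1) ^ m * (pi ^ (2 * m) * euler_poly (2 * m + 1) 1)
                  / (fact (2 * m + 2 * k + 1) * 2 ^ (2 * m)))"
proof -
  let ?t = "\<lambda>m. (-1) ^ m * (pi ^ (2 * m) * euler_poly (2 * m + 1) 1)
             / (fact (2 * m + 2 * k + 1) * 2 ^ (2 * m))"
  let ?T = "tan_integral (2 * k) (pi / 2)"
  define p :: real where "p = (pi / 2) ^ (2 * k + 1)"
  have p: "p \<noteq> 0" by (simp add: p_def)
  have "(\<lambda>m. (-1) ^ m * euler_poly (2 * m + 1) 1 * (pi / 2) ^ (2 * m + 1 + 2 * k)
            / fact (2 * m + 1 + 2 * k)) sums ?T"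
    using pi_half_less_two by (intro tan_integral_sums) simp
  moreover have "(-1) ^ m * euler_poly (2 * m + 1) 1 * (pi / 2) ^ (2 * m + 1 + 2 * k)
            / fact (2 * m + 1 + 2 * k) = ?t m * p" for m
  proof -
    have exps: "2 * m + 1 + 2 * k = 2 * m + 2 * k + 1" by simp
    have pow: "(pi / 2) ^ (2 * m + 2 * k + 1) = pi ^ (2 * m) / 2 ^ (2 * m) * p"
      unfolding p_def by (simp add: power_add power_divide mult_ac)
    have "a * e * (P / Q * p) / F = a * (P * e) / (F * Q) * p" for a e P Q F :: real
      by (simp add: mult_ac)
    then show ?thesis unfolding exps pow .
  qed
  ultimately have "(\<lambda>m. ?t m * p) sums ?T" by simp
  then have "(\<lambda>m. ?t m * p / p) sums (?T / p)" by (rule sums_divide)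
  then have t: "?t sums (?T / p)" using p by simp
  then have "?T / 2 = p / 2 * suminf ?t"
    using p by (simp add: sums_iff)
  also have "p / 2 = pi ^ (2 * k + 1) / 2 ^ (2 * k + 2)"
    by (simp add: p_def power_divide)
  finally have T: "?T / 2 = pi ^ (2 * k + 1) / 2 ^ (2 * k + 2) * suminf ?t" .
  let ?S = "\<Sum>m = 1..k - 1. ((-1) ^ m * (pi / 2) ^ (2 * k - 2 * m - 1) / fact (2 * k - 2 * m - 1))
            * (1 - 1 / 2 ^ (2 * m)) * riemann_zeta (real (2 * m + 1))"
  let ?L = "(pi / 2) ^ (2 * k - 1) / fact (2 * k - 1) * ln 2"
  have "?T / 2 = (-1) ^ k * dirichlet_beta (real (2 * k)) + ?L + ?S"
    unfolding tan_integral_even_pi_half[OF assms] by (simp add: mult.assoc)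
  then have "(-1) ^ k * (?T / 2) =
      (-1) ^ k * ((-1) ^ k * dirichlet_beta (real (2 * k))) + (-1) ^ k * ?L + (-1) ^ k * ?S"
    by (simp only: distrib_left)
  also have "(-1) ^ k * ((-1) ^ k * dirichlet_beta (real (2 * k))) = dirichlet_beta (real (2 * k))"
    by simp
  finally have "dirichlet_beta (real (2 * k)) =
      - ((-1) ^ k * ?L) - (-1) ^ k * ?S + (-1) ^ k * (?T / 2)"
    by linarith
  moreover have "- ((-1) ^ k * ?L) =
      (-1) ^ (k + 1) * ((pi / 2) ^ (2 * k - 1) / fact (2 * k - 1)) * ln 2"
    by simp
  ultimately have "dirichlet_beta (real (2 * k)) =
      (-1) ^ (k + 1) * ((pi / 2) ^ (2 * k - 1) / fact (2 * k - 1)) * ln 2 - (-1) ^ k * ?S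
      + (-1) ^ k * (?T / 2)"
    by simp
  then show ?thesis
    unfolding T using sums_summable[OF t] by (simp only: mult.assoc simp_thms)
qed

end
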